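(* Let $\alpha_1,\alpha_2,\alpha_3\in(0,1]$, $A\in\mathbb{R}^{3\times 3}$, and suppose that the characteristic function $Q(s)=\det(\operatorname{diag}(s^{\alpha_1},s^{\alpha_2},s^{\alpha_3})-A)$ has the form $$Q(s)=s^{\beta_4}-a s^{\beta_3}-b s^{\beta_2}-c s^{\beta_1}-d,$$ where $\beta_4=\alpha_1+\alpha_2+\alpha_3$, $a,b,c\in\mathbb{R}$ and $d=\det A$. Let $0<\beta_1<\beta_2<\beta_3<\beta_4<2$. If $a,b,c\le 0$ and $d<0$, then all zeros of $Q$ are in the open left half of $\mathbb{C}$.
   Context: Complex powers are taken with the principal branch: $s^\beta=|s|^\beta e^{\mathrm{i}\beta\arg s}$ with $\arg s\in(-\pi,\pi]$ for $s\neq 0$, and $0^\beta=0$ for $\beta>0$. *)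

theory Defs
  imports "HOL-Analysis.Analysis"
begin

definition diag_mat :: "'a::zero ^ 'n \<Rightarrow> 'a ^ 'n ^ 'n" where
  "diag_mat v = (\<chi> i j. if i = j then v $ i else 0)"

(* Complex powr is the principal branch: it is defined through Ln,
   whose imaginary part lies in (-pi, pi], and 0 powr w = 0. *)
definition char_fun :: "real ^ 'n \<Rightarrow> real ^ 'n ^ 'n \<Rightarrow> complex \<Rightarrow> complex" where
  "char_fun \<alpha> A s =
     det (diag_mat (\<chi> i. s powr of_real (\<alpha> $ i)) - map_matrix of_real A)"

end

theory Submission
  imports Defs
begin

text \<open>If $\operatorname{Re} s \ge 0$ and $s \ne 0$, then $|\arg s| \le \pi/2$, so for every exponent
  $\beta \in (0,2)$ the power $s^\beta$ has argument $\beta \arg s \in (-\pi, \pi)$ and its imaginary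
  part has the sign of $\arg s$. A combination of such powers with nonnegative coefficients therefore
  cannot be real unless $\arg s = 0$, and in that case it is nonnegative, so that $-d > 0$ keeps $Q(s)$
  away from zero.\<close>

text \<open>The expression is even in \<open>t\<close>, so \<open>t\<close> may be replaced by its
  absolute value; then \<open>\<beta> * \<bar>t\<bar>\<close> lies in (0, pi), where sine is
  positive.\<close>

lemma mult_sin_pos:
  fixes \<beta> t :: real
  assumes "0 < \<beta>" "\<beta> < 2" "\<bar>t\<bar> \<le> pi / 2" "t \<noteq> 0"
  shows "0 < t * sin (\<beta> * t)"
proof -
  have "0 < \<bar>t\<bar> * sin (\<beta> * \<bar>t\<bar>)"
  proof (intro mult_pos_pos sin_gt_zero)
    have "\<beta> * \<bar>t\<bar> < 2 * \<bar>t\<bar>"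
      using assms by simp
    then show "\<beta> * \<bar>t\<bar> < pi"
      using assms by linarith
  qed (use assms in simp_all)
  also have "\<bar>t\<bar> * sin (\<beta> * \<bar>t\<bar>) = t * sin (\<beta> * t)"
    by (simp add: abs_if)
  finally show ?thesis .
qed

text \<open>Stating the sign agreement as a product treats the upper and lower half planes at once
  and lets such terms be added up without a case split.\<close>

lemma Im_powr_of_real_sign:
  fixes s :: complex and \<beta> :: real
  assumes "s \<noteq> 0" "0 \<le> Re s" "Im (Ln s) \<noteq> 0" "0 < \<beta>" "\<beta> < 2"
  shows "0 < Im (Ln s) * Im (s powr of_real \<beta>)"
proof -
  have "\<bar>Im (Ln s)\<bar> \<le> pi / 2"
    using assms Re_Ln_pos_le by blast
  then have "0 < Im (Ln s) * sin (\<beta> * Im (Ln s))"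
    using assms mult_sin_pos by blast
  \<comment> \<open>The exponential factor is the modulus of \<open>s powr of_real \<beta>\<close>;
    it turns the sine into the imaginary part.\<close>
  then have "0 < exp (\<beta> * Re (Ln s)) * (Im (Ln s) * sin (\<beta> * Im (Ln s)))"
    by simp
  then show ?thesis
    using assms by (simp add: powr_def Im_exp mult_ac)
qed

text \<open>Here \<open>Ln s\<close> is real, so the power is the exponential of a real
  number.\<close>

lemma Re_powr_of_real_pos:
  fixes s :: complex and \<beta> :: real
  assumes "s \<noteq> 0" "Im (Ln s) = 0"
  shows "0 < Re (s powr of_real \<beta>)"
  using assms by (simp add: powr_def Re_exp)

lemma fractional_quadrinomial_nonzero:
  fixes s :: complex and p q r d \<beta>\<^sub>1 \<beta>\<^sub>2 \<beta>\<^sub>3 \<beta>\<^sub>4 :: real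
  assumes "0 \<le> Re s"
    and "\<beta>\<^sub>1 \<in> {0<..<2}" "\<beta>\<^sub>2 \<in> {0<..<2}" "\<beta>\<^sub>3 \<in> {0<..<2}" "\<beta>\<^sub>4 \<in> {0<..<2}"
    and "0 \<le> p" "0 \<le> q" "0 \<le> r" "0 < d"
  shows "s powr of_real \<beta>\<^sub>4 + of_real p * s powr of_real \<beta>\<^sub>3 + of_real q * s powr of_real \<beta>\<^sub>2
      + of_real r * s powr of_real \<beta>\<^sub>1 + of_real d \<noteq> 0" (is "?Q \<noteq> 0")
proof (cases "s = 0")
  case True
  \<comment> \<open>All powers vanish at 0, since \<open>0 powr w = 0\<close>; only
    \<open>d > 0\<close> is left.\<close>
  then show ?thesis
    using assms by simp
next
  case s: False
  show ?thesis
  proof (cases "Im (Ln s) = 0")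
    case True
    have pos: "0 < Re (s powr of_real \<beta>)" for \<beta>
      using s True by (rule Re_powr_of_real_pos)
    have "0 < Re ?Q"
      using assms pos[of \<beta>\<^sub>4]
      by (simp add: add_pos_nonneg add_nonneg_pos less_imp_le[OF pos])
    then show ?thesis
      by (metis less_irrefl zero_complex.sel(1))
  next
    case False
    have pos: "0 < Im (Ln s) * Im (s powr of_real \<beta>)" if "\<beta> \<in> {0<..<2}" for \<beta>
      using s False assms that by (intro Im_powr_of_real_sign) auto
    \<comment> \<open>The real constant \<open>d\<close> drops out of the imaginary part; the
      \<open>\<beta>\<^sub>4\<close> term, with coefficient 1, makes the sum strictly
      positive.\<close>
    have "Im (Ln s) * Im ?Q =
        Im (Ln s) * Im (s powr of_real \<beta>\<^sub>4) + p * (Im (Ln s) * Im (s powr of_real \<beta>\<^sub>3))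
        + q * (Im (Ln s) * Im (s powr of_real \<beta>\<^sub>2)) + r * (Im (Ln s) * Im (s powr of_real \<beta>\<^sub>1))"
      by (simp add: algebra_simps)
    also have "\<dots> > 0"
      using assms by (intro add_pos_nonneg mult_nonneg_nonneg pos less_imp_le[OF pos])
    finally show ?thesis
      by (metis less_irrefl mult_zero_right zero_complex.sel(2))
  qed
qed

theorem lemma10:
  fixes \<alpha> :: "real ^ 3" and A :: "real ^ 3 ^ 3"
    and \<beta>\<^sub>1 \<beta>\<^sub>2 \<beta>\<^sub>3 \<beta>\<^sub>4 a b c d :: real
  assumes "\<And>i. 0 < \<alpha> $ i \<and> \<alpha> $ i \<le> 1"
    and "\<And>s :: complex. char_fun \<alpha> A s =
           s powr of_real \<beta>\<^sub>4 - of_real a * s powr of_real \<beta>\<^sub>3 - of_real b * s powr of_real \<beta>\<^sub>2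
           - of_real c * s powr of_real \<beta>\<^sub>1 - of_real d"
    and "\<beta>\<^sub>4 = \<alpha> $ 1 + \<alpha> $ 2 + \<alpha> $ 3"
    and "d = det A"
    and "0 < \<beta>\<^sub>1" and "\<beta>\<^sub>1 < \<beta>\<^sub>2" and "\<beta>\<^sub>2 < \<beta>\<^sub>3" and "\<beta>\<^sub>3 < \<beta>\<^sub>4" and "\<beta>\<^sub>4 < 2"
    and "a \<le> 0" and "b \<le> 0" and "c \<le> 0" and "d < 0"
  shows "{s :: complex. char_fun \<alpha> A s = 0} \<subseteq> {s. Re s < 0}"
proof safe
  fix s :: complex
  assume zero: "char_fun \<alpha> A s = 0"
  show "Re s < 0"
  proof (rule ccontr)
    assume "\<not> Re s < 0"
    \<comment> \<open>Negating the coefficients makes them nonnegative, and the chain of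
      inequalities puts every exponent in (0, 2).\<close>
    then have "s powr of_real \<beta>\<^sub>4 + of_real (- a) * s powr of_real \<beta>\<^sub>3
        + of_real (- b) * s powr of_real \<beta>\<^sub>2 + of_real (- c) * s powr of_real \<beta>\<^sub>1 + of_real (- d) \<noteq> 0"
      using assms by (intro fractional_quadrinomial_nonzero) auto
    then show False
      using zero assms(2)[of s] by simp
  qed
qed

end
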